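(* Let $F$ be a solution of the $G_{n,n}$-system, $E$ a frame of $F$, $0\ne s\in\mathbb R$ a constant, $\beta\in O(n)$ a constant matrix, $E(x,-is)=\begin{pmatrix}\eta_1&\eta_2\\\eta_3&\eta_4\end{pmatrix}$ ($n\times n$ blocks) and $\tilde\beta=(i\eta_4-\beta\eta_2)^{-1}(i\beta\eta_1+\eta_3)$. Write $E(x,0)=\begin{pmatrix}A(x)&0\\0&B(x)\end{pmatrix}$. Let $$N(x)=E(x,1)\begin{pmatrix}A(x)^t&0\\0&I_n\end{pmatrix},\qquad\tilde N(x)=N(x)\begin{pmatrix}A&0\\0&I_n\end{pmatrix}\begin{pmatrix}\cos\rho\,\tilde\beta^t&-\sin\rho\,I_n\\\sin\rho\,I_n&\cos\rho\,\tilde\beta\end{pmatrix}\begin{pmatrix}\tilde A^t&0\\0&I_n\end{pmatrix},$$ where $\rho=\arctan(1/s)$ and $\tilde A=A\tilde\beta^t$. Let $v_i$ and $\tilde v_i$ denote the $i$-th columns of $N$ and $\tilde N$ respectively. Then the map $v_1(x)\mapsto\tilde v_1(x)$ is a Bäcklund transformation of $n$-dimensional submanifolds in $S^{2n-1}$ with constant $\rho$.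
   Context: $gl_*(n)$: real $n\times n$ matrices with zero diagonal; $\delta=\mathrm{diag}(dx_1,\dots,dx_n)$; $I_{n,n}=\mathrm{diag}(I_n,-I_n)$. A map $F:\mathbb R^n\to gl_*(n)$ is a solution of the $G_{n,n}$-system if $$\theta_\lambda=\lambda\begin{pmatrix}0&-\delta\\\delta&0\end{pmatrix}+\begin{pmatrix}-F\delta+\delta F^t&0\\0&-F^t\delta+\delta F\end{pmatrix}$$ is flat ($d\theta_\lambda+\theta_\lambda\wedge\theta_\lambda=0$) for all $\lambda\in\mathbb C$. A frame of $F$ is a trivialization of this Lax connection, $E^{-1}dE=\theta_\lambda$, satisfying $\overline{E(x,\bar\lambda)}=E(x,\lambda)$, $I_{n,n}E(x,\lambda)I_{n,n}^{-1}=E(x,-\lambda)$, $EE^t=I$; then $E(x,0)\in O(n)\times O(n)$. Bäcklund transformation with constant $\rho$: let $M,\tilde M$ be $n$-dimensional submanifolds in $S^{2n-1}$, with immersions $X,\tilde X$. A diffeomorphism $\ell:M\to\tilde M$ is a Bäcklund transformation with constant $\rho$ if there exist local orthonormal frames of $M,\tilde M$, with $e_1,\dots,e_n$ and $\tilde e_1,\dots,\tilde e_n$ tangent, such that $\{e_\alpha\}_{\alpha=n+1}^{2n-1}$ and $\{\tilde e_\alpha\}_{\alpha=n+1}^{2n-1}$ are parallel normal frames for $M,\tilde M$ in $S^{2n-1}$ respectively, and $$(\tilde X,\tilde e_{n+1},\dots,\tilde e_{2n-1},\tilde e_1,\dots,\tilde e_n)(\ell(x))=(X,e_{n+1},\dots,e_{2n-1},e_1,\dots,e_n)(x)\begin{pmatrix}\cos\rho\,I_n&-\sin\rho\,I_n\\\sin\rho\,I_n&\cos\rho\,I_n\end{pmatrix}$$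 for all $x\in M$.
   Formalization: The claim is made on every open set of x where both v_1 and ṽ_1 are immersions; without this it fails, e.g. for F = 0, A = I, n ≥ 2, where v_1 depends on x_1 alone and is not an n-dimensional submanifold. *)

theory Defs
  imports "HOL-Analysis.Analysis"
begin

subsection \<open>Smooth maps\<close>

text \<open>Only meant for open sets, since derivatives are taken at full neighbourhoods.\<close>

primrec C_k_on ::
  "nat \<Rightarrow> ('a::euclidean_space) set \<Rightarrow> ('a \<Rightarrow> 'b::real_normed_vector) \<Rightarrow> bool" where
  "C_k_on 0 S f \<longleftrightarrow> continuous_on S f"
| "C_k_on (Suc k) S f \<longleftrightarrow>
     (\<forall>x\<in>S. f differentiable at x) \<and>
     (\<forall>u. C_k_on k S (\<lambda>x. frechet_derivative f (at x) u))"

definition smooth_on ::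
  "('a::euclidean_space) set \<Rightarrow> ('a \<Rightarrow> 'b::real_normed_vector) \<Rightarrow> bool" where
  "smooth_on S f \<longleftrightarrow> (\<forall>k. C_k_on k S f)"

definition diffeomorphism_on ::
  "('a::euclidean_space) set \<Rightarrow> ('b::euclidean_space) set \<Rightarrow> ('a \<Rightarrow> 'b) \<Rightarrow> bool" where
  "diffeomorphism_on U V l \<longleftrightarrow>
     (\<exists>m. homeomorphism U V l m \<and> smooth_on U l \<and> smooth_on V m)"

subsection \<open>Block matrices\<close>

text \<open>The index set of size \<open>2n\<close> is \<open>'n + 'n\<close>: \<open>Inl\<close> is the first and \<open>Inr\<close> the second half.\<close>

definition block ::
  "'a^'n^'n \<Rightarrow> 'a^'n^'n \<Rightarrow> 'a^'n^'n \<Rightarrow> 'a^'n^'n \<Rightarrow> 'a^('n + 'n)^('n::finite + 'n)" where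
  "block P Q R S = (\<chi> i j. case i of
      Inl a \<Rightarrow> (case j of Inl b \<Rightarrow> P $ a $ b | Inr b \<Rightarrow> Q $ a $ b)
    | Inr a \<Rightarrow> (case j of Inl b \<Rightarrow> R $ a $ b | Inr b \<Rightarrow> S $ a $ b))"

abbreviation cmat :: "real^'m^'k \<Rightarrow> complex^'m^'k" where
  "cmat \<equiv> map_matrix complex_of_real"

definition cvec :: "real^'m \<Rightarrow> complex^'m" where
  "cvec v = (\<chi> i. complex_of_real (v $ i))"

definition cscale :: "complex \<Rightarrow> complex^'m^'k \<Rightarrow> complex^'m^'k" where
  "cscale c = map_matrix ((*) c)"

definition I_nn :: "complex^('n + 'n)^('n::finite + 'n)" where
  "I_nn = block (mat 1) 0 0 (- mat 1)"

subsection \<open>Flat matrix-valued 1-forms\<close>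

text \<open>
  A 1-form \<open>\<omega>\<close> on \<open>\<real>\<^sup>n\<close> is given by its values \<open>\<omega> x u\<close> on tangent vectors \<open>u\<close> at \<open>x\<close>.
  Then \<open>d\<omega>(u, v) = D\<^sub>u(\<omega>(v)) - D\<^sub>v(\<omega>(u))\<close> for constant \<open>u, v\<close>, and
  \<open>(\<omega> \<and> \<omega>)(u, v) = \<omega>(u) \<omega>(v) - \<omega>(v) \<omega>(u)\<close>.
\<close>

definition exterior_derivative ::
  "(real^'n \<Rightarrow> real^'n \<Rightarrow> complex^'m^'m) \<Rightarrow> real^'n \<Rightarrow> real^'n \<Rightarrow> real^'n \<Rightarrow> complex^'m^'m" where
  "exterior_derivative \<omega> x u v =
     frechet_derivative (\<lambda>y. \<omega> y v) (at x) u - frechet_derivative (\<lambda>y. \<omega> y u) (at x) v"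

definition wedge_self ::
  "(real^'n \<Rightarrow> real^'n \<Rightarrow> complex^'m^'m) \<Rightarrow> real^'n \<Rightarrow> real^'n \<Rightarrow> real^'n \<Rightarrow> complex^'m^'m" where
  "wedge_self \<omega> x u v = \<omega> x u ** \<omega> x v - \<omega> x v ** \<omega> x u"

definition flat_connection :: "(real^'n \<Rightarrow> real^'n \<Rightarrow> complex^'m^'m) \<Rightarrow> bool" where
  "flat_connection \<omega> \<longleftrightarrow> (\<forall>x u v. exterior_derivative \<omega> x u v + wedge_self \<omega> x u v = 0)"

subsection \<open>The \<open>G\<^sub>n\<^sub>,\<^sub>n\<close>-system\<close>

text \<open>\<open>delta u\<close> is \<open>\<delta> = diag(dx\<^sub>1, \<dots>, dx\<^sub>n)\<close> evaluated on the tangent vector \<open>u\<close>.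
  The spectral parameter is called \<open>\<mu>\<close>.\<close>

definition delta :: "real^'n \<Rightarrow> real^'n^'n" where
  "delta u = (\<chi> i j. if i = j then u $ i else 0)"

definition theta ::
  "(real^'n \<Rightarrow> real^'n^'n) \<Rightarrow> complex \<Rightarrow> real^'n \<Rightarrow> real^'n \<Rightarrow> complex^('n + 'n)^('n::finite + 'n)"
  where
  "theta F \<mu> x u =
     cscale \<mu> (cmat (block 0 (- delta u) (delta u) 0)) +
     cmat (block (- (F x ** delta u) + delta u ** transpose (F x)) 0
                 0 (- (transpose (F x) ** delta u) + delta u ** F x))"

definition Gnn_solution :: "(real^'n \<Rightarrow> real^'n^'n) \<Rightarrow> bool" where
  "Gnn_solution F \<longleftrightarrow>
     smooth_on UNIV F \<and> (\<forall>x i. F x $ i $ i = 0) \<and> (\<forall>\<mu>. flat_connection (theta F \<mu>))"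

definition is_frame ::
  "(real^'n \<Rightarrow> real^'n^'n) \<Rightarrow> (real^'n \<Rightarrow> complex \<Rightarrow> complex^('n + 'n)^('n::finite + 'n)) \<Rightarrow> bool"
  where
  "is_frame F E \<longleftrightarrow>
     (\<forall>\<mu>. smooth_on UNIV (\<lambda>x. E x \<mu>)) \<and>
     (\<forall>\<mu> x u. matrix_inv (E x \<mu>) ** frechet_derivative (\<lambda>y. E y \<mu>) (at x) u = theta F \<mu> x u) \<and>
     (\<forall>x \<mu>. map_matrix cnj (E x (cnj \<mu>)) = E x \<mu>) \<and>
     (\<forall>x \<mu>. I_nn ** E x \<mu> ** matrix_inv I_nn = E x (- \<mu>)) \<and>
     (\<forall>x \<mu>. E x \<mu> ** transpose (E x \<mu>) = mat 1)"

subsection \<open>Immersed submanifolds of the sphere and Baecklund transformations\<close>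

text \<open>
  An \<open>n\<close>-dimensional submanifold of \<open>S\<^sup>2\<^sup>n\<^sup>-\<^sup>1\<close> is an immersed one, given by an open parameter domain
  \<open>U \<subseteq> \<real>\<^sup>n\<close> and an immersion \<open>X\<close>. Points of the submanifold are parameters; \<open>X\<close> need not be
  injective, so a map \<open>X x \<mapsto> Y y\<close> between submanifolds is a map \<open>x \<mapsto> y\<close> of parameter domains.
\<close>

definition immersed_submanifold ::
  "(real^'n) set \<Rightarrow> (real^'n \<Rightarrow> real^('n::finite + 'n)) \<Rightarrow> bool" where
  "immersed_submanifold U X \<longleftrightarrow>
     open U \<and> smooth_on U X \<and> X ` U \<subseteq> sphere 0 1 \<and>
     (\<forall>x\<in>U. inj (frechet_derivative X (at x)))"

definition tangent_space ::
  "(real^'n \<Rightarrow> real^('n::finite + 'n)) \<Rightarrow> real^'n \<Rightarrow> (real^('n + 'n)) set" where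
  "tangent_space X x = range (frechet_derivative X (at x))"

text \<open>Normal space within the sphere, whence also orthogonal to the position vector.\<close>

definition normal_space ::
  "(real^'n \<Rightarrow> real^('n::finite + 'n)) \<Rightarrow> real^'n \<Rightarrow> (real^('n + 'n)) set" where
  "normal_space X x = {w. w \<bullet> X x = 0 \<and> (\<forall>t\<in>tangent_space X x. w \<bullet> t = 0)}"

text \<open>
  The normal connection is \<open>\<nabla>\<^sub>u\<xi>\<close> = orthogonal projection of \<open>D\<^sub>u\<xi>\<close> to the normal space; it vanishes
  iff \<open>D\<^sub>u\<xi>\<close> is orthogonal to the normal space.
\<close>

definition parallel_normal_field ::
  "(real^'n) set \<Rightarrow> (real^'n \<Rightarrow> real^('n + 'n)) \<Rightarrow> (real^'n \<Rightarrow> real^('n::finite + 'n)) \<Rightarrow> bool" where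
  "parallel_normal_field W X \<xi> \<longleftrightarrow>
     (\<forall>x\<in>W. \<xi> x \<in> normal_space X x \<and>
        (\<forall>u. \<forall>w\<in>normal_space X x. frechet_derivative \<xi> (at x) u \<bullet> w = 0))"

text \<open>
  \<open>g\<close> is the matrix \<open>(X, e\<^sub>n\<^sub>+\<^sub>1, \<dots>, e\<^sub>2\<^sub>n\<^sub>-\<^sub>1, e\<^sub>1, \<dots>, e\<^sub>n)\<close> of an orthonormal frame over \<open>W\<close>. As a finite type
  has no first element, the label \<open>k\<close> plays the role of the index \<open>1\<close>: column \<open>Inl k\<close> is \<open>X\<close>, the
  other columns \<open>Inl j\<close> are the normal vectors and the columns \<open>Inr i\<close> the tangent vectors.
\<close>

definition adapted_frame ::
  "'n \<Rightarrow> (real^'n) set \<Rightarrow> (real^'n \<Rightarrow> real^('n + 'n)) \<Rightarrow>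
   (real^'n \<Rightarrow> real^('n + 'n)^('n::finite + 'n)) \<Rightarrow> bool" where
  "adapted_frame k W X g \<longleftrightarrow>
     smooth_on W g \<and>
     (\<forall>x\<in>W. orthogonal_matrix (g x) \<and> column (Inl k) (g x) = X x \<and>
        (\<forall>i. column (Inr i) (g x) \<in> tangent_space X x)) \<and>
     (\<forall>j. j \<noteq> k \<longrightarrow> parallel_normal_field W X (\<lambda>x. column (Inl j) (g x)))"

definition baecklund_transformation ::
  "'n \<Rightarrow> real \<Rightarrow> (real^'n) set \<Rightarrow> (real^'n \<Rightarrow> real^('n + 'n)) \<Rightarrow>
   (real^'n) set \<Rightarrow> (real^'n \<Rightarrow> real^('n + 'n)) \<Rightarrow> (real^'n \<Rightarrow> real^'n::finite) \<Rightarrow> bool" where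
  "baecklund_transformation k \<rho> U X V Y l \<longleftrightarrow>
     immersed_submanifold U X \<and> immersed_submanifold V Y \<and> diffeomorphism_on U V l \<and>
     (\<forall>p\<in>U. \<exists>W g h. open W \<and> p \<in> W \<and> W \<subseteq> U \<and>
        adapted_frame k W X g \<and> adapted_frame k (l ` W) Y h \<and>
        (\<forall>x\<in>W. h (l x) = g x ** block (cos \<rho> *\<^sub>R mat 1) (- sin \<rho> *\<^sub>R mat 1)
                                      (sin \<rho> *\<^sub>R mat 1) (cos \<rho> *\<^sub>R mat 1)))"

end

theory Submission
  imports Defs
begin

text \<open>
  Conjugation by \<open>diag(1, i)\<close> makes the frame at \<open>-is\<close> a real \<open>O(n,n)\<close>-valued matrix, and
  \<open>T = \<beta>t\<close> is its fractional linear image of \<open>\<beta>\<close>. Hence \<open>T\<close> is defined everywhere, orthogonal, and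
  solves the Riccati equation \<open>dT = T a - b T + s (T \<delta> T - \<delta>)\<close> with \<open>a = -F\<delta> + \<delta>F\<^sup>t\<close> and
  \<open>b = -F\<^sup>t\<delta> + \<delta>F\<close>. The frame \<open>g = E(\<cdot>, 1) diag(A\<^sup>t, T A\<^sup>t)\<close> has \<open>g\<^sup>-\<^sup>1 dg\<close> with vanishing upper left
  block. Wherever column \<open>Inl k\<close> is an immersion, this makes the last \<open>n\<close> columns tangent to it and the
  remaining ones parallel normal fields. Since \<open>cos \<rho> = s sin \<rho>\<close>, the Riccati equation gives the same
  property to \<open>g\<close> times the rotation by \<open>\<rho>\<close>, whose column \<open>Inl k\<close> is that of \<open>Nt\<close>.
\<close>

subsection \<open>Matrix algebra\<close>

lemma sum_UNIV_Plus: "(\<Sum>i\<in>UNIV. f i) = (\<Sum>i\<in>UNIV. f (Inl i)) + (\<Sum>i\<in>UNIV. f (Inr i))"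
  for f :: "'a::finite + 'b::finite \<Rightarrow> 'c::comm_monoid_add"
  using sum.Plus[of "UNIV :: 'a set" "UNIV :: 'b set" f] by simp

lemma block_nth [simp]:
  "block P Q R S $ Inl a $ Inl b = P $ a $ b" "block P Q R S $ Inl a $ Inr b = Q $ a $ b"
  "block P Q R S $ Inr a $ Inl b = R $ a $ b" "block P Q R S $ Inr a $ Inr b = S $ a $ b"
  by (simp_all add: block_def)

lemma vec_eq_iff_Plus: "x = y \<longleftrightarrow> (\<forall>a. x $ Inl a = y $ Inl a) \<and> (\<forall>a. x $ Inr a = y $ Inr a)"
  by (metis vec_eq_iff sum.exhaust)

lemma matrix_eq_iff_block:
  "M = M' \<longleftrightarrow> (\<forall>a b. M $ Inl a $ Inl b = M' $ Inl a $ Inl b \<and> M $ Inl a $ Inr b = M' $ Inl a $ Inr b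
     \<and> M $ Inr a $ Inl b = M' $ Inr a $ Inl b \<and> M $ Inr a $ Inr b = M' $ Inr a $ Inr b)"
  by (auto simp: vec_eq_iff_Plus)

lemma block_inject:
  "block P Q R S = block P' Q' R' S' \<longleftrightarrow> P = P' \<and> Q = Q' \<and> R = R' \<and> S = S'"
  by (auto simp: matrix_eq_iff_block vec_eq_iff)

lemma block_mult:
  "block P Q R S ** block P' Q' R' S' =
     block (P ** P' + Q ** R') (P ** Q' + Q ** S') (R ** P' + S ** R') (R ** Q' + S ** S')"
  by (simp add: matrix_eq_iff_block matrix_matrix_mult_def sum_UNIV_Plus)

lemma block_add: "block P Q R S + block P' Q' R' S' = block (P + P') (Q + Q') (R + R') (S + S')"
  by (simp add: matrix_eq_iff_block)

lemma block_transpose: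
  "transpose (block P Q R S) = block (transpose P) (transpose R) (transpose Q) (transpose S)"
  by (simp add: matrix_eq_iff_block transpose_def)

lemma block_one: "block (mat 1) 0 0 (mat 1) = mat 1"
  by (simp add: matrix_eq_iff_block mat_def)

lemma map_matrix_block:
  "map_matrix f (block P Q R S) =
     block (map_matrix f P) (map_matrix f Q) (map_matrix f R) (map_matrix f S)"
  by (simp add: matrix_eq_iff_block)

lemma cscale_block: "cscale c (block P Q R S) = block (cscale c P) (cscale c Q) (cscale c R) (cscale c S)"
  by (simp add: cscale_def map_matrix_block)

lemma matrix_diff_ldistrib: "A ** (B - C) = A ** B - A ** C" for A :: "'a::ring_1^'n^'m"
  by (simp add: vec_eq_iff matrix_matrix_mult_def algebra_simps sum_subtractf)

lemma matrix_diff_rdistrib: "(B - C) ** A = B ** A - C ** A" for A :: "'a::ring_1^'n^'m"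
  by (simp add: vec_eq_iff matrix_matrix_mult_def algebra_simps sum_subtractf)

lemma matrix_add_rdistrib: "(B + C) ** A = B ** A + C ** A"
  by (simp add: vec_eq_iff matrix_matrix_mult_def algebra_simps sum.distrib)

lemma matrix_minus_mult_left: "(- A) ** B = - (A ** B)" for A :: "'a::ring_1^'n^'m"
  by (simp add: vec_eq_iff matrix_matrix_mult_def sum_negf)

lemma matrix_minus_mult_right: "A ** (- B) = - (A ** B)" for A :: "'a::ring_1^'n^'m"
  by (simp add: vec_eq_iff matrix_matrix_mult_def sum_negf)

lemma matrix_scaleR_mult_left: "(c *\<^sub>R A) ** B = c *\<^sub>R (A ** B)" for A :: "'a::real_algebra_1^'n^'m"
  by (simp add: vec_eq_iff matrix_matrix_mult_def scaleR_sum_right)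

lemma matrix_scaleR_mult_right: "A ** (c *\<^sub>R B) = c *\<^sub>R (A ** B)" for A :: "'a::real_algebra_1^'n^'m"
  by (simp add: vec_eq_iff matrix_matrix_mult_def scaleR_sum_right)

lemma transpose_add: "transpose (A + B) = transpose A + transpose B"
  by (simp add: vec_eq_iff transpose_def)

lemma transpose_diff: "transpose (A - B) = transpose A - transpose B"
  by (simp add: vec_eq_iff transpose_def)

lemma transpose_minus: "transpose (- A) = - transpose A"
  by (simp add: vec_eq_iff transpose_def)

lemma transpose_zero: "transpose 0 = 0"
  by (simp add: vec_eq_iff transpose_def)

lemmas matrix_ring_simps = matrix_add_ldistrib matrix_add_rdistrib matrix_diff_ldistrib
  matrix_diff_rdistrib matrix_minus_mult_left matrix_minus_mult_right matrix_scaleR_mult_left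
  matrix_scaleR_mult_right matrix_mul_assoc[symmetric]

lemmas transpose_simps = matrix_transpose_mul transpose_add transpose_diff transpose_minus
  transpose_scalar transpose_zero

text \<open>\<open>matrix_inv\<close> is defined by choice. Over a field a one-sided inverse of a
  square matrix is two-sided, so the choice has a witness, and uniqueness of inverses fixes its
  value.\<close>

lemma matrix_inv_eqI:
  fixes M :: "'a::field^'n^'n"
  assumes "M ** L = mat 1"
  shows "matrix_inv M = L"
proof -
  have "\<exists>L. M ** L = mat 1 \<and> L ** M = mat 1"
    using assms matrix_left_right_inverse[of M L] by blast
  then have "matrix_inv M ** M = mat 1"
    unfolding matrix_inv_def by (rule someI2_ex) simp
  then show ?thesis
    by (metis assms matrix_mul_assoc matrix_mul_lid matrix_mul_rid)
qed

subsection \<open>Real and complex matrices\<close>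

lemma cmat_mult: "cmat (A ** B) = cmat A ** cmat B"
  by (simp add: vec_eq_iff matrix_matrix_mult_def)

lemma cmat_add: "cmat (A + B) = cmat A + cmat B"
  by (simp add: vec_eq_iff)

lemma cmat_diff: "cmat (A - B) = cmat A - cmat B"
  by (simp add: vec_eq_iff)

lemma cmat_minus: "cmat (- A) = - cmat A"
  by (simp add: vec_eq_iff)

lemma cmat_zero: "cmat 0 = 0"
  by (simp add: vec_eq_iff)

lemma cmat_scaleR: "cmat (c *\<^sub>R A) = c *\<^sub>R cmat A"
  by (simp add: vec_eq_iff scaleR_conv_of_real[where 'a=complex])

lemma cmat_one: "cmat (mat 1) = mat 1"
  by (simp add: vec_eq_iff mat_def)

lemma cmat_transpose: "cmat (transpose A) = transpose (cmat A)"
  by (simp add: vec_eq_iff transpose_def)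

lemma cmat_eq_iff [simp]: "cmat A = cmat B \<longleftrightarrow> A = B"
  by (simp add: vec_eq_iff)

lemma Re_cmat [simp]: "map_matrix Re (cmat A) = A"
  by (simp add: vec_eq_iff)

lemmas cmat_simps = cmat_mult cmat_add cmat_diff cmat_minus cmat_zero cmat_scaleR cmat_one
  cmat_transpose

lemma cscale_mult_left: "cscale c A ** B = cscale c (A ** B)"
  by (simp add: vec_eq_iff matrix_matrix_mult_def cscale_def sum_distrib_left mult_ac)

lemma cscale_mult_right: "A ** cscale c B = cscale c (A ** B)"
  by (simp add: vec_eq_iff matrix_matrix_mult_def cscale_def sum_distrib_left mult_ac)

lemma cscale_cscale: "cscale c (cscale d A) = cscale (c * d) A"
  by (simp add: vec_eq_iff cscale_def)

lemma cscale_one: "cscale 1 A = A"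
  by (simp add: vec_eq_iff cscale_def)

lemma transpose_cscale: "transpose (cscale c A) = cscale c (transpose A)"
  by (simp add: vec_eq_iff transpose_def cscale_def)

lemma cscale_of_real: "cscale (of_real c) A = c *\<^sub>R A"
  by (simp add: vec_eq_iff cscale_def scaleR_conv_of_real[where 'a=complex])

lemma cscale_minus: "cscale (- c) A = - cscale c A" "cscale c (- A) = - cscale c A"
  by (simp_all add: vec_eq_iff cscale_def)

lemma cscale_add: "cscale c (A + B) = cscale c A + cscale c B"
  "cscale c (A - B) = cscale c A - cscale c B" "cscale c 0 = 0"
  by (simp_all add: vec_eq_iff cscale_def algebra_simps)

subsection \<open>Smooth maps\<close>

lemma C_k_on_SucD: "C_k_on (Suc k) S f \<Longrightarrow> C_k_on k S f"
proof (induction k arbitrary: f)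
  case 0
  then show ?case
    by (auto intro!: continuous_at_imp_continuous_on differentiable_imp_continuous_within)
next
  case (Suc k)
  then show ?case
    by (metis C_k_on.simps(2))
qed

lemma C_k_on_subset: "C_k_on k S f \<Longrightarrow> T \<subseteq> S \<Longrightarrow> C_k_on k T f"
  by (induction k arbitrary: f) (auto intro: continuous_on_subset)

lemma smooth_on_subset: "smooth_on S f \<Longrightarrow> T \<subseteq> S \<Longrightarrow> smooth_on T f"
  by (auto simp: smooth_on_def intro: C_k_on_subset)

lemma smooth_on_imp_differentiable: "smooth_on S f \<Longrightarrow> x \<in> S \<Longrightarrow> f differentiable at x"
  unfolding smooth_on_def by (metis C_k_on.simps(2))

lemma C_k_on_const: "C_k_on k S (\<lambda>x. c)"
  by (induction k arbitrary: c) simp_all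

lemma C_k_on_ident: "C_k_on k S (\<lambda>x. x)"
  by (cases k) (simp_all add: C_k_on_const continuous_on_id)

text \<open>A bounded linear map commutes with differentiation, so the induction passes to
  directional derivatives. This and the following closure properties live on the whole space, where
  frames are defined; restriction to an open set comes last.\<close>

lemma C_k_on_bounded_linear:
  assumes "bounded_linear L" "C_k_on k UNIV f"
  shows "C_k_on k UNIV (\<lambda>x. L (f x))"
  using assms(2)
proof (induction k arbitrary: f)
  case 0
  then show ?case
    using bounded_linear.continuous_on[OF assms(1)] by simp
next
  case (Suc k)
  then have f: "(f has_derivative frechet_derivative f (at x)) (at x)" for x
    by (simp add: frechet_derivative_works[symmetric])
  note L = bounded_linear.has_derivative[OF assms(1) f]
  have "frechet_derivative (\<lambda>x. L (f x)) (at x) = (\<lambda>u. L (frechet_derivative f (at x) u))" for x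
    using L by (rule frechet_derivative_at[symmetric])
  then show ?case
    using Suc by (auto intro: differentiableI[OF L])
qed

lemma C_k_on_add:
  assumes "C_k_on k UNIV f" "C_k_on k UNIV g"
  shows "C_k_on k UNIV (\<lambda>x. f x + g x)"
  using assms
proof (induction k arbitrary: f g)
  case 0
  then show ?case
    by (simp add: continuous_on_add)
next
  case (Suc k)
  then have f: "(f has_derivative frechet_derivative f (at x)) (at x)"
    and g: "(g has_derivative frechet_derivative g (at x)) (at x)" for x
    by (simp_all add: frechet_derivative_works[symmetric])
  note fg = has_derivative_add[OF f g]
  have eq: "frechet_derivative (\<lambda>x. f x + g x) (at x) =
      (\<lambda>u. frechet_derivative f (at x) u + frechet_derivative g (at x) u)" for x
    using fg by (rule frechet_derivative_at[symmetric])
  show ?case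
    unfolding C_k_on.simps eq
    using Suc by (auto intro: differentiableI[OF fg])
qed

text \<open>By the product rule each summand of the derivative keeps one factor undifferentiated.
  \<open>C_k_on_SucD\<close> lowers the class of that factor, so the induction hypothesis applies to
  both summands.\<close>

lemma C_k_on_bounded_bilinear:
  assumes "bounded_bilinear B" "C_k_on k UNIV f" "C_k_on k UNIV g"
  shows "C_k_on k UNIV (\<lambda>x. B (f x) (g x))"
  using assms(2,3)
proof (induction k arbitrary: f g)
  case 0
  then show ?case
    using bounded_bilinear.continuous_on[OF assms(1)] by simp
next
  case (Suc k)
  then have f: "(f has_derivative frechet_derivative f (at x)) (at x)"
    and g: "(g has_derivative frechet_derivative g (at x)) (at x)" for x
    by (simp_all add: frechet_derivative_works[symmetric])
  note B = bounded_bilinear.FDERIV[OF assms(1) f g]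
  have eq: "frechet_derivative (\<lambda>x. B (f x) (g x)) (at x) =
      (\<lambda>u. B (f x) (frechet_derivative g (at x) u) + B (frechet_derivative f (at x) u) (g x))" for x
    using B by (rule frechet_derivative_at[symmetric])
  show ?case
    unfolding C_k_on.simps eq
    using Suc C_k_on_SucD[OF Suc.prems(1)] C_k_on_SucD[OF Suc.prems(2)]
    by (auto intro: differentiableI[OF B] intro!: C_k_on_add)
qed
text \<open>Serves for a map whose derivative is known through an equation, as with the Riccati
  equation.\<close>

lemma C_k_on_SucI:
  assumes f: "\<And>x. (f has_derivative f' x) (at x)" and "\<And>u. C_k_on k UNIV (\<lambda>x. f' x u)"
  shows "C_k_on (Suc k) UNIV f"
proof -
  have "frechet_derivative f (at x) = f' x" for x
    using f by (rule frechet_derivative_at[symmetric])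
  then show ?thesis
    using assms(2) by (auto intro: differentiableI[OF f])
qed

section \<open>Smoothness of matrix products and block matrices\<close>

lemma bounded_bilinear_matrix_mult: "bounded_bilinear (\<lambda>(A::real^'n^'m) (B::real^'p^'n). A ** B)"
  unfolding bilinear_conv_bounded_bilinear[symmetric] bilinear_def
  by (auto intro!: linearI simp: matrix_add_ldistrib matrix_add_rdistrib matrix_scaleR_mult_left
      matrix_scaleR_mult_right)

lemmas matrix_mult_has_derivative = bounded_bilinear.FDERIV[OF bounded_bilinear_matrix_mult]

lemma C_k_on_matrix_mult:
  "C_k_on k UNIV f \<Longrightarrow> C_k_on k UNIV g \<Longrightarrow> C_k_on k UNIV (\<lambda>x. f x ** g x)"
  for f :: "'a::euclidean_space \<Rightarrow> real^'n^'m"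
  by (rule C_k_on_bounded_bilinear[OF bounded_bilinear_matrix_mult])

lemma smooth_on_matrix_mult:
  "smooth_on UNIV f \<Longrightarrow> smooth_on UNIV g \<Longrightarrow> smooth_on UNIV (\<lambda>x. f x ** g x)"
  for f :: "'a::euclidean_space \<Rightarrow> real^'n^'m"
  by (simp add: smooth_on_def C_k_on_matrix_mult)

lemma smooth_on_bounded_linear:
  "bounded_linear L \<Longrightarrow> smooth_on UNIV f \<Longrightarrow> smooth_on UNIV (\<lambda>x. L (f x))"
  by (simp add: smooth_on_def C_k_on_bounded_linear)

lemma smooth_on_linear:
  "linear L \<Longrightarrow> smooth_on UNIV f \<Longrightarrow> smooth_on UNIV (\<lambda>x. L (f x))"
  for f :: "'a::euclidean_space \<Rightarrow> 'b::euclidean_space"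
  by (simp add: smooth_on_bounded_linear linear_conv_bounded_linear)

lemma smooth_on_const: "smooth_on S (\<lambda>x. c)"
  by (simp add: smooth_on_def C_k_on_const)

lemma smooth_on_add: "smooth_on UNIV f \<Longrightarrow> smooth_on UNIV g \<Longrightarrow> smooth_on UNIV (\<lambda>x. f x + g x)"
  by (simp add: smooth_on_def C_k_on_add)

lemma linear_block:
  "linear (\<lambda>P. block P 0 0 0 :: real^('n + 'n)^('n::finite + 'n))"
  "linear (\<lambda>P. block 0 0 0 P :: real^('n + 'n)^('n::finite + 'n))"
  by (auto intro!: linearI simp: matrix_eq_iff_block)

lemma smooth_on_block_diag:
  fixes P S :: "'a::euclidean_space \<Rightarrow> real^'n^'n"
  assumes "smooth_on UNIV P" "smooth_on UNIV S"
  shows "smooth_on UNIV (\<lambda>x. block (P x) 0 0 (S x))"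
proof -
  have "smooth_on UNIV (\<lambda>x. block (P x) 0 0 0 + block 0 0 0 (S x))"
    by (rule smooth_on_add[OF smooth_on_linear[OF linear_block(1) assms(1)]
          smooth_on_linear[OF linear_block(2) assms(2)]])
  then show ?thesis
    by (simp add: block_add)
qed

lemma block_diag_has_derivative:
  fixes P S :: "'a::euclidean_space \<Rightarrow> real^'n^'n"
  assumes "(P has_derivative P') F" "(S has_derivative S') F"
  shows "((\<lambda>x. block (P x) 0 0 (S x)) has_derivative (\<lambda>u. block (P' u) 0 0 (S' u))) F"
proof -
  have "((\<lambda>x. block (P x) 0 0 0 + block 0 0 0 (S x)) has_derivative
      (\<lambda>u. block (P' u) 0 0 0 + block 0 0 0 (S' u))) F"
    by (rule has_derivative_add[OF
          bounded_linear.has_derivative[OF linear_block(1)[unfolded linear_conv_bounded_linear] assms(1)]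
          bounded_linear.has_derivative[OF linear_block(2)[unfolded linear_conv_bounded_linear] assms(2)]])
  then show ?thesis
    by (simp add: block_add)
qed

lemma linear_transpose: "linear (transpose :: real^'n^'m \<Rightarrow> _)"
  by (rule linearI) (simp_all add: transpose_add transpose_scalar)

lemma linear_column: "linear (column j :: real^'n^'m \<Rightarrow> _)"
  by (rule linearI) (simp_all add: column_def vec_eq_iff)

section \<open>Differentiability of the solution of a linear matrix equation\<close>

lemma differentiable_matrix_iff:
  fixes M :: "'a::euclidean_space \<Rightarrow> real^'n^'m"
  shows "M differentiable at x \<longleftrightarrow> (\<forall>i j. (\<lambda>y. M y $ i $ j) differentiable at x)"
proof
  assume "M differentiable at x"
  then obtain M' where "(M has_derivative M') (at x)"
    by (auto simp: differentiable_def)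
  then have "((\<lambda>y. M y $ i $ j) has_derivative (\<lambda>u. M' u $ i $ j)) (at x)" for i j
    by (rule bounded_linear.has_derivative[OF bounded_linear_vec_nth
          bounded_linear.has_derivative[OF bounded_linear_vec_nth]])
  then show "\<forall>i j. (\<lambda>y. M y $ i $ j) differentiable at x"
    by (auto simp: differentiable_def)
next
  assume "\<forall>i j. (\<lambda>y. M y $ i $ j) differentiable at x"
  then show "M differentiable at x"
    by (subst differentiable_componentwise_within) (auto simp: Basis_vec_def inner_axis)
qed

lemma differentiable_prod:
  fixes f :: "'i \<Rightarrow> 'a::real_normed_vector \<Rightarrow> real"
  assumes "\<And>i. i \<in> I \<Longrightarrow> f i differentiable (at x)"
  shows "(\<lambda>y. \<Prod>i\<in>I. f i y) differentiable (at x)"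
proof -
  obtain f' where "\<And>i. i \<in> I \<Longrightarrow> (f i has_derivative f' i) (at x)"
    using assms unfolding differentiable_def by metis
  then show ?thesis
    by (intro differentiableI[OF has_derivative_prod])
qed

lemma differentiable_det:
  fixes M :: "'a::euclidean_space \<Rightarrow> real^'n^'n"
  assumes "M differentiable (at x)"
  shows "(\<lambda>y. det (M y)) differentiable (at x)"
proof -
  have "(\<lambda>y. M y $ i $ j) differentiable (at x)" for i j
    using assms by (simp add: differentiable_matrix_iff)
  then show ?thesis
    unfolding det_def
    by (intro differentiable_sum differentiable_mult differentiable_prod differentiable_const
        finite_permutations ballI) simp_all
qed

text \<open>Cramer's rule, applied to each column, writes the entries of \<open>T\<close> as
  quotients of determinants whose entries come from \<open>a\<close> and \<open>b\<close>.\<close>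

lemma differentiable_matrix_solve:
  fixes b a T :: "'a::euclidean_space \<Rightarrow> real^'n^'n"
  assumes b: "b differentiable (at x)" and a: "a differentiable (at x)"
    and det: "\<And>y. det (b y) \<noteq> 0" and eq: "\<And>y. b y ** T y = a y"
  shows "T differentiable (at x)"
proof -
  have *: "T y $ i $ j = det (\<chi> p q. if q = i then a y $ p $ j else b y $ p $ q) / det (b y)" for y i j
  proof -
    have "b y *v column j (T y) = column j (a y)"
      by (simp add: eq[symmetric] vec_eq_iff column_def matrix_matrix_mult_def matrix_vector_mult_def)
    then have "column j (T y) = (\<chi> k. det (\<chi> p q. if q = k then column j (a y) $ p else b y $ p $ q) / det (b y))"
      using cramer[OF det] by blast
    then have "column j (T y) $ i = det (\<chi> p q. if q = i then column j (a y) $ p else b y $ p $ q) / det (b y)"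
      by simp
    then show ?thesis
      by (simp add: column_def cong: if_cong)
  qed
  have "(\<lambda>y. (\<chi> p q. if q = i then a y $ p $ j else b y $ p $ q) :: real^'n^'n) differentiable (at x)" for i j
  proof -
    have "(\<lambda>y. if q = i then a y $ p $ j else b y $ p $ q) differentiable (at x)" for p q
      using a b by (cases "q = i") (simp_all add: differentiable_matrix_iff)
    then show ?thesis
      by (simp add: differentiable_matrix_iff)
  qed
  then have "(\<lambda>y. T y $ i $ j) differentiable (at x)" for i j
    unfolding * using b det by (intro differentiable_divide differentiable_det) auto
  then show ?thesis
    by (simp add: differentiable_matrix_iff)
qed

subsection \<open>Adapted frames\<close>

lemma matrix_mult_lower:
  fixes g :: "real^('n + 'n)^('n::finite + 'n)"
  assumes "\<And>a. w $ Inl a = 0"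
  shows "g *v w = (\<Sum>i\<in>UNIV. w $ Inr i *\<^sub>R column (Inr i) g)"
  using assms
  by (simp add: vec_eq_iff matrix_vector_mult_def sum_UNIV_Plus column_def mult.commute)

lemma column_inner_orthogonal:
  fixes g :: "real^'m^'m"
  assumes "orthogonal_matrix g"
  shows "column i g \<bullet> column j g = (if i = j then 1 else 0)"
  using assms unfolding orthogonal_matrix_orthonormal_columns
  by (auto simp: orthogonal_def norm_eq_1)

lemma column_matrix_mult: "column j (g ** M) = g *v column j M"
  by (simp add: vec_eq_iff column_def matrix_matrix_mult_def matrix_vector_mult_def)

section \<open>Frames whose connection form has vanishing upper left block\<close>

context
  fixes g :: "real^'n \<Rightarrow> real^('n + 'n)^('n::finite + 'n)" and \<Omega> k x
  assumes orth: "orthogonal_matrix (g x)"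
    and deriv: "(g has_derivative (\<lambda>u. g x ** \<Omega> u)) (at x)"
    and upper: "\<And>u a b. \<Omega> u $ Inl a $ Inl b = 0"
    and imm: "inj (frechet_derivative (\<lambda>x. column (Inl k) (g x)) (at x))"
begin

text \<open>A column of \<open>g x ** \<Omega> u\<close> combines the columns of \<open>g x\<close>
  with coefficients from the same column of \<open>\<Omega> u\<close>; \<open>upper\<close> removes
  the first half of them.\<close>

lemma column_Inl_frechet:
  "frechet_derivative (\<lambda>x. column (Inl j) (g x)) (at x) u = (\<Sum>i\<in>UNIV. \<Omega> u $ Inr i $ Inl j *\<^sub>R column (Inr i) (g x))"
proof -
  have "((\<lambda>x. column (Inl j) (g x)) has_derivative (\<lambda>u. column (Inl j) (g x ** \<Omega> u))) (at x)"
    by (rule bounded_linear.has_derivative[OF linear_column[unfolded linear_conv_bounded_linear] deriv])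
  then have "frechet_derivative (\<lambda>x. column (Inl j) (g x)) (at x) = (\<lambda>u. column (Inl j) (g x ** \<Omega> u))"
    by (rule frechet_derivative_at[symmetric])
  moreover have "column (Inl j) (g x ** \<Omega> u) = (\<Sum>i\<in>UNIV. \<Omega> u $ Inr i $ Inl j *\<^sub>R column (Inr i) (g x))"
    unfolding column_matrix_mult by (subst matrix_mult_lower) (simp_all add: upper column_def)
  ultimately show ?thesis
    by simp
qed

text \<open>The coefficients in the derivative of column \<open>Inl k\<close> form a linear map of
  \<open>u\<close> between spaces of equal dimension. The immersion property makes it injective,
  hence surjective, so each single column \<open>Inr i\<close> is attained.\<close>

lemma column_Inr_tangent: "column (Inr i) (g x) \<in> tangent_space (\<lambda>x. column (Inl k) (g x)) x"
proof -
  let ?L = "\<lambda>u. (\<chi> i. \<Omega> u $ Inr i $ Inl k) :: real^'n"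
  have inv: "transpose (g x) ** (g x ** M) = M" for M
    using orth by (simp add: matrix_mul_assoc orthogonal_matrix_def)
  \<comment> \<open>Linearity of \<open>\<Omega>\<close> is not assumed; it is recovered from that
    of the derivative by cancelling \<open>g x\<close>.\<close>
  have "linear (\<lambda>u. g x ** \<Omega> u)"
    using deriv by (rule has_derivative_linear)
  moreover have "linear (\<lambda>M. transpose (g x) ** M)"
    by (rule linearI) (simp_all add: matrix_add_ldistrib matrix_scaleR_mult_right)
  ultimately have "linear ((\<lambda>M. transpose (g x) ** M) \<circ> (\<lambda>u. g x ** \<Omega> u))"
    by (rule linear_compose)
  then have lin: "linear \<Omega>"
    by (simp add: o_def inv)
  have "linear ?L"
    by (rule linearI) (simp_all add: linear_add[OF lin] linear_scale[OF lin] vec_eq_iff)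
  moreover have "inj ?L"
  proof (rule injI)
    fix u v assume "?L u = ?L v"
    then have "frechet_derivative (\<lambda>x. column (Inl k) (g x)) (at x) u = frechet_derivative (\<lambda>x. column (Inl k) (g x)) (at x) v"
      unfolding column_Inl_frechet by (simp add: vec_eq_iff)
    with imm show "u = v"
      by (simp add: inj_eq)
  qed
  ultimately have "surj ?L"
    by (rule linear_injective_imp_surjective) simp
  \<comment> \<open>In the direction \<open>u\<close> all coefficients but the one at
    \<open>i\<close> vanish, so the derivative is exactly column \<open>Inr i\<close>.\<close>
  from surjD[OF this, of "axis i 1"] obtain u where u: "axis i 1 = ?L u"
    by (rule exE)
  have "\<Omega> u $ Inr a $ Inl k = axis i 1 $ a" for a
    by (subst u) simp
  then have "\<Omega> u $ Inr a $ Inl k = (if a = i then 1 else 0)" for a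
    by (simp add: axis_def)
  then have "frechet_derivative (\<lambda>x. column (Inl k) (g x)) (at x) u = column (Inr i) (g x)"
    unfolding column_Inl_frechet by (simp add: if_distrib[where f="\<lambda>c. c *\<^sub>R _"] cong: if_cong)
  then show ?thesis
    unfolding tangent_space_def by (rule range_eqI[OF sym])
qed

text \<open>Tangent vectors are combinations of the \<open>Inr\<close> columns and the position
  vector is column \<open>Inl k\<close>, so orthonormality suffices.\<close>

lemma column_Inl_normal:
  assumes "j \<noteq> k"
  shows "column (Inl j) (g x) \<in> normal_space (\<lambda>x. column (Inl k) (g x)) x"
  using assms by (auto simp: normal_space_def tangent_space_def column_Inl_frechet inner_sum_right
      column_inner_orthogonal[OF orth])

text \<open>Parallelism: the derivative is a combination of the \<open>Inr\<close> columns, which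
  are tangent.\<close>

lemma column_Inl_derivative_tangential:
  assumes "w \<in> normal_space (\<lambda>x. column (Inl k) (g x)) x"
  shows "frechet_derivative (\<lambda>x. column (Inl j) (g x)) (at x) u \<bullet> w = 0"
  using assms column_Inr_tangent
  by (simp add: normal_space_def column_Inl_frechet inner_sum_right inner_commute[of _ w])

end

lemma adapted_frameI:
  assumes "smooth_on W g"
    and "\<And>x. x \<in> W \<Longrightarrow> orthogonal_matrix (g x)"
    and "\<And>x. x \<in> W \<Longrightarrow> (g has_derivative (\<lambda>u. g x ** \<Omega> x u)) (at x)"
    and "\<And>x u a b. x \<in> W \<Longrightarrow> \<Omega> x u $ Inl a $ Inl b = 0"
    and "\<And>x. x \<in> W \<Longrightarrow> inj (frechet_derivative (\<lambda>x. column (Inl k) (g x)) (at x))"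
  shows "adapted_frame k W (\<lambda>x. column (Inl k) (g x)) g"
  unfolding adapted_frame_def parallel_normal_field_def
  using assms column_Inr_tangent[OF assms(2-5)] column_Inl_normal[OF assms(2-5)]
    column_Inl_derivative_tangential[OF assms(2-5)]
  by blast

lemma immersed_submanifold_columnI:
  fixes g :: "real^'n \<Rightarrow> real^('n + 'n)^('n::finite + 'n)"
  assumes "open U" "smooth_on UNIV g" "\<And>x. orthogonal_matrix (g x)"
    and "\<And>x. x \<in> U \<Longrightarrow> inj (frechet_derivative (\<lambda>x. column (Inl k) (g x)) (at x))"
  shows "immersed_submanifold U (\<lambda>x. column (Inl k) (g x))"
  unfolding immersed_submanifold_def
proof (intro conjI ballI)
  show "smooth_on U (\<lambda>x. column (Inl k) (g x))"
    using smooth_on_linear[OF linear_column assms(2)] by (rule smooth_on_subset) simp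
  show "(\<lambda>x. column (Inl k) (g x)) ` U \<subseteq> sphere 0 1"
    using assms(3) by (auto simp: orthogonal_matrix_orthonormal_columns)
qed (use assms in auto)

lemma diffeomorphism_on_ident: "diffeomorphism_on U U (\<lambda>x. x)"
  unfolding diffeomorphism_on_def
  by (intro exI[of _ "\<lambda>x. x"]) (simp add: homeomorphism_def smooth_on_def C_k_on_ident)

lemma block_has_derivative_blocks:
  fixes P Q R S :: "'a::real_normed_vector \<Rightarrow> real^'n^'n"
  assumes "((\<lambda>x. block (P x) (Q x) (R x) (S x)) has_derivative
      (\<lambda>u. block (P' u) (Q' u) (R' u) (S' u))) F"
  shows "(P has_derivative P') F" "(Q has_derivative Q') F"
    "(R has_derivative R') F" "(S has_derivative S') F"
proof -
  \<comment> \<open>The arguments \<open>i\<close> and \<open>j\<close> are the constructors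
    \<open>Inl\<close> and \<open>Inr\<close>, so one family of linear maps reads off all four
    blocks.\<close>
  let ?B = "\<lambda>i j. (\<lambda>M. \<chi> a b. M $ i a $ j b) :: real^('n + 'n)^('n + 'n) \<Rightarrow> real^'n^'n"
  have "linear (?B i j)" for i j
    by (rule linearI) (simp_all add: vec_eq_iff)
  then have "bounded_linear (?B i j)" for i j
    by (simp add: linear_conv_bounded_linear)
  note * = bounded_linear.has_derivative[OF this assms]
  show "(P has_derivative P') F" "(Q has_derivative Q') F"
    "(R has_derivative R') F" "(S has_derivative S') F"
    using *[of Inl Inl] *[of Inl Inr] *[of Inr Inl] *[of Inr Inr] by simp_all
qed

subsection \<open>Frames\<close>

text \<open>Common shape of the two diagonal blocks of \<open>theta\<close>: \<open>X = F x\<close>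
  gives the upper one, \<open>X = transpose (F x)\<close> the lower one. Its values are
  skew-symmetric because \<open>delta u\<close> is symmetric.\<close>

definition gauge_form :: "real^'n^'n \<Rightarrow> real^'n \<Rightarrow> real^'n^'n" where
  "gauge_form X u = - (X ** delta u) + delta u ** transpose X"

lemma transpose_delta: "transpose (delta u) = delta u"
  by (auto simp: delta_def transpose_def vec_eq_iff)

lemma transpose_gauge_form: "transpose (gauge_form X u) = - gauge_form X u"
  by (simp add: gauge_form_def transpose_simps transpose_delta)

lemma theta_eq:
  "theta F \<mu> x u = block (cmat (gauge_form (F x) u)) (cscale \<mu> (cmat (- delta u)))
     (cscale \<mu> (cmat (delta u))) (cmat (gauge_form (transpose (F x)) u))"
  by (simp add: theta_def gauge_form_def map_matrix_block cscale_block block_add cmat_zero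
      cscale_add)

text \<open>The relation \<open>E E^t = I\<close> identifies \<open>matrix_inv\<close> with the
  transpose, so \<open>E^{-1} dE = theta\<close> can be solved for \<open>dE\<close>.\<close>

lemma frame_has_derivative:
  assumes "is_frame F E"
  shows "((\<lambda>x. E x \<mu>) has_derivative (\<lambda>u. E x \<mu> ** theta F \<mu> x u)) (at x)"
proof -
  have E: "E x \<mu> ** transpose (E x \<mu>) = mat 1"
    and eq: "\<And>u. matrix_inv (E x \<mu>) ** frechet_derivative (\<lambda>y. E y \<mu>) (at x) u = theta F \<mu> x u"
    and "smooth_on UNIV (\<lambda>x. E x \<mu>)"
    using assms by (auto simp: is_frame_def)
  then have "(\<lambda>x. E x \<mu>) differentiable at x"
    by (simp add: smooth_on_imp_differentiable)
  moreover have "frechet_derivative (\<lambda>y. E y \<mu>) (at x) = (\<lambda>u. E x \<mu> ** theta F \<mu> x u)"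
    by (rule ext) (simp add: eq[symmetric] matrix_inv_eqI[OF E] matrix_mul_assoc E)
  ultimately show ?thesis
    by (simp add: frechet_derivative_works)
qed

text \<open>Constant conjugation by \<open>D\<close> preserves the equation
  \<open>dE = E theta\<close>: the product \<open>D' ** D\<close> is inserted between the factors.
  Taking real parts is real linear, so the equation descends to real matrices. It is used with
  \<open>D\<close> the identity at 0 and 1, and with \<open>diag(1, i)\<close> at
  \<open>-is\<close>.\<close>

lemma frame_real_form:
  fixes m :: "real^'n \<Rightarrow> real^('n + 'n)^('n::finite + 'n)"
  assumes frame: "is_frame F E"
    and D: "D' ** D = mat 1"
    and m: "\<And>y. D ** E y \<mu> ** D' = cmat (m y)"
    and \<Omega>: "\<And>x u. D ** theta F \<mu> x u ** D' = cmat (\<Omega> x u)"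
  shows "smooth_on UNIV m" "(m has_derivative (\<lambda>u. m x ** \<Omega> x u)) (at x)"
proof -
  let ?L = "\<lambda>M. map_matrix Re (D ** M ** D') :: real^('n + 'n)^('n + 'n)"
  have m': "m = (\<lambda>y. ?L (E y \<mu>))"
    by (simp add: m)
  have L: "linear ?L"
    by (rule linearI) (simp_all add: matrix_ring_simps vec_eq_iff)
  show "smooth_on UNIV m"
    unfolding m' using frame by (intro smooth_on_linear[OF L]) (simp add: is_frame_def)
  have "?L (E x \<mu> ** theta F \<mu> x u) = m x ** \<Omega> x u" for u
  proof -
    have "D ** (E x \<mu> ** theta F \<mu> x u) ** D' = D ** E x \<mu> ** (D' ** D) ** theta F \<mu> x u ** D'"
      by (simp add: D matrix_mul_assoc)
    also have "\<dots> = (D ** E x \<mu> ** D') ** (D ** theta F \<mu> x u ** D')"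
      by (simp add: matrix_mul_assoc)
    also have "\<dots> = cmat (m x ** \<Omega> x u)"
      by (simp add: m \<Omega> cmat_mult)
    finally show ?thesis
      by simp
  qed
  moreover have "((\<lambda>y. ?L (E y \<mu>)) has_derivative (\<lambda>u. ?L (E x \<mu> ** theta F \<mu> x u))) (at x)"
    by (rule bounded_linear.has_derivative[OF L[unfolded linear_conv_bounded_linear]
          frame_has_derivative[OF frame]])
  ultimately show "(m has_derivative (\<lambda>u. m x ** \<Omega> x u)) (at x)"
    unfolding m'[symmetric] by simp
qed

text \<open>The frame condition uses the transpose without conjugation, so for a real value it is
  ordinary orthogonality.\<close>

lemma frame_orthogonal:
  assumes "is_frame F E" "E x \<mu> = cmat M"
  shows "orthogonal_matrix M"
proof -
  have "cmat (M ** transpose M) = cmat (mat 1)"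
    using assms by (simp add: is_frame_def cmat_simps flip: assms(2))
  then show ?thesis
    by (simp add: orthogonal_matrix matrix_left_right_inverse)
qed

text \<open>The parameter 1 is its own conjugate, so the reality condition makes the entries of the
  frame real.\<close>

lemma frame_at_one:
  assumes "is_frame F E"
  obtains R where "\<And>x. E x 1 = cmat (R x)" "\<And>x. orthogonal_matrix (R x)" "smooth_on UNIV R"
    "\<And>x. (R has_derivative (\<lambda>u. R x ** block (gauge_form (F x) u) (- delta u) (delta u)
       (gauge_form (transpose (F x)) u))) (at x)"
proof -
  have "map_matrix cnj (E x (cnj 1)) = E x 1" for x
    using assms unfolding is_frame_def by blast
  then have "cnj (E x 1 $ i $ j) = E x 1 $ i $ j" for x i j
    by (metis complex_cnj_one nth_map_matrix)
  then have R: "E x 1 = cmat (map_matrix Re (E x 1))" for x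
    by (simp add: vec_eq_iff complex_eq_iff)
  have "theta F 1 x u = cmat (block (gauge_form (F x) u) (- delta u) (delta u)
       (gauge_form (transpose (F x)) u))" for x u
    by (simp add: theta_eq map_matrix_block cscale_one)
  note frame_real_form[OF assms, of "mat 1" "mat 1" 1, simplified, OF R this]
  then show ?thesis
    using that[OF R frame_orthogonal[OF assms R]] by blast
qed

text \<open>At parameter 0 the connection is block diagonal, and the equation for the frame splits
  into one for each block.\<close>

lemma frame_at_zero:
  fixes A :: "real^'n \<Rightarrow> real^'n^'n::finite"
  assumes frame: "is_frame F E" and E0: "\<And>x. E x 0 = cmat (block (A x) 0 0 (B x))"
  shows "orthogonal_matrix (A x)" "smooth_on UNIV A"
    "(A has_derivative (\<lambda>u. A x ** gauge_form (F x) u)) (at x)"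
proof -
  have cs0: "cscale 0 M = 0" for M :: "complex^'n^'n"
    by (simp add: cscale_def vec_eq_iff)
  have th: "theta F 0 x u = cmat (block (gauge_form (F x) u) 0 0 (gauge_form (transpose (F x)) u))" for x u
    by (simp add: theta_eq map_matrix_block cs0 cmat_zero)
  have "orthogonal_matrix (block (A x) 0 0 (B x))" for x
    using frame_orthogonal[OF frame E0] .
  then show "orthogonal_matrix (A x)"
    by (simp add: orthogonal_matrix block_transpose block_mult block_inject transpose_zero
        flip: block_one)
  note * = frame_real_form[OF frame, of "mat 1" "mat 1" 0 "\<lambda>x. block (A x) 0 0 (B x)", simplified, OF E0 th]
  show "(A has_derivative (\<lambda>u. A x ** gauge_form (F x) u)) (at x)"
    by (rule block_has_derivative_blocks(1)) (use *(2)[of x] in \<open>simp add: block_mult\<close>)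
  have "linear (\<lambda>M :: real^('n + 'n)^('n + 'n). \<chi> a b. M $ Inl a $ Inl b)"
    by (rule linearI) (simp_all add: vec_eq_iff)
  from smooth_on_linear[OF this *(1)] show "smooth_on UNIV A"
    by simp
qed

text \<open>Conjugation and negation agree on \<open>-is\<close>. The reality condition and the
  \<open>I_nn\<close> symmetry together therefore make the diagonal blocks real and the off-diagonal
  blocks purely imaginary.\<close>

lemma frame_at_imaginary:
  fixes \<eta>\<^sub>1 :: "real^'n \<Rightarrow> complex^'n^'n"
  assumes frame: "is_frame F E"
    and E: "\<And>x. E x (- (\<i> * complex_of_real s)) = block (\<eta>\<^sub>1 x) (\<eta>\<^sub>2 x) (\<eta>\<^sub>3 x) (\<eta>\<^sub>4 x)"
  obtains P Q R S where
    "\<And>x. \<eta>\<^sub>1 x = cmat (P x)" "\<And>x. \<eta>\<^sub>2 x = cscale \<i> (cmat (Q x))"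
    "\<And>x. \<eta>\<^sub>3 x = cscale (- \<i>) (cmat (R x))" "\<And>x. \<eta>\<^sub>4 x = cmat (S x)"
    "\<And>x. block (P x) (Q x) (R x) (S x) ** block (mat 1) 0 0 (- mat 1)
       ** transpose (block (P x) (Q x) (R x) (S x)) = block (mat 1) 0 0 (- mat 1)"
    "\<And>x. ((\<lambda>x. block (P x) (Q x) (R x) (S x)) has_derivative
       (\<lambda>u. block (P x) (Q x) (R x) (S x) ** block (gauge_form (F x) u) (s *\<^sub>R delta u)
         (s *\<^sub>R delta u) (gauge_form (transpose (F x)) u))) (at x)"
proof -
  let ?\<mu> = "- (\<i> * complex_of_real s)"
  have I_inv: "matrix_inv I_nn = (I_nn :: complex^('n + 'n)^('n + 'n))"
    by (rule matrix_inv_eqI) (simp add: I_nn_def block_mult matrix_ring_simps block_one)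
  have "E x ?\<mu> = map_matrix cnj (I_nn ** E x ?\<mu> ** I_nn)" for x
  proof -
    have "map_matrix cnj (E x (cnj ?\<mu>)) = E x ?\<mu>" "I_nn ** E x ?\<mu> ** I_nn = E x (- ?\<mu>)"
      using frame unfolding is_frame_def by (metis, metis I_inv)
    then show ?thesis
      by simp
  qed
  then have conj: "\<eta>\<^sub>1 x = map_matrix cnj (\<eta>\<^sub>1 x)" "\<eta>\<^sub>2 x = map_matrix cnj (- \<eta>\<^sub>2 x)"
      "\<eta>\<^sub>3 x = map_matrix cnj (- \<eta>\<^sub>3 x)" "\<eta>\<^sub>4 x = map_matrix cnj (\<eta>\<^sub>4 x)" for x
    by (simp_all add: E I_nn_def block_mult matrix_ring_simps map_matrix_block block_inject)
  define P where "P x = map_matrix Re (\<eta>\<^sub>1 x)" for x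
  define Q where "Q x = map_matrix Im (\<eta>\<^sub>2 x)" for x
  define R where "R x = - map_matrix Im (\<eta>\<^sub>3 x)" for x
  define S where "S x = map_matrix Re (\<eta>\<^sub>4 x)" for x
  have real: "z = of_real (Re z)" if "z = cnj z" for z
    using that by (simp add: complex_eq_iff)
  have imag: "z = \<i> * of_real (Im z)" if "z = cnj (- z)" for z
    using that by (simp add: complex_eq_iff)
  have P: "\<eta>\<^sub>1 x = cmat (P x)" and S: "\<eta>\<^sub>4 x = cmat (S x)" for x
    using conj(1,4)[of x] by (simp_all add: P_def S_def vec_eq_iff real)
  \<comment> \<open>The opposite signs of the factors are those that conjugation by
    \<open>?D\<close> removes, leaving \<open>Q x\<close> and \<open>R x\<close>.\<close>
  have Q: "\<eta>\<^sub>2 x = cscale \<i> (cmat (Q x))" and R: "\<eta>\<^sub>3 x = cscale (- \<i>) (cmat (R x))" for x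
    using conj(2,3)[of x] by (simp_all add: Q_def R_def vec_eq_iff imag cscale_def)
  let ?D = "block (mat 1) 0 0 (cscale \<i> (mat 1)) :: complex^('n + 'n)^('n + 'n)"
  let ?D' = "block (mat 1) 0 0 (cscale (- \<i>) (mat 1)) :: complex^('n + 'n)^('n + 'n)"
  have D: "?D' ** ?D = mat 1"
    by (simp add: block_mult cscale_mult_left cscale_mult_right cscale_cscale cscale_one cscale_add
        block_one)
  have QE: "?D ** E x ?\<mu> ** ?D' = cmat (block (P x) (Q x) (R x) (S x))" for x
    by (simp add: E P Q R S block_mult cscale_mult_left cscale_mult_right cscale_cscale cscale_one
        cscale_add map_matrix_block)
  have i_s: "\<i> * complex_of_real s * \<i> = - complex_of_real s"
    by (simp add: complex_eq_iff)
  \<comment> \<open>Both off-diagonal blocks become \<open>s *\<^sub>R delta u\<close>: the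
    skew-symmetric part of the connection turns symmetric, as befits the Lie algebra of
    \<open>O(n,n)\<close>.\<close>
  have D\<theta>: "?D ** theta F ?\<mu> x u ** ?D' = cmat (block (gauge_form (F x) u) (s *\<^sub>R delta u)
         (s *\<^sub>R delta u) (gauge_form (transpose (F x)) u))" for x u
    by (simp add: theta_eq block_mult cscale_mult_left cscale_mult_right cscale_cscale cscale_one
        map_matrix_block cmat_minus cscale_minus cmat_scaleR mult.assoc[symmetric]
        i_s cscale_of_real cscale_add matrix_minus_mult_right)
  have pseudo: "block (P x) (Q x) (R x) (S x) ** block (mat 1) 0 0 (- mat 1)
       ** transpose (block (P x) (Q x) (R x) (S x)) = block (mat 1) 0 0 (- mat 1)" for x
  proof -
    have "E x ?\<mu> ** transpose (E x ?\<mu>) = mat 1"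
      using frame unfolding is_frame_def by blast
    \<comment> \<open>The signature arises from \<open>?D ** ?D = diag(1, -1)\<close>; this product
      appears on the right, and on the left between the conjugated frame and its transpose.\<close>
    then have "?D ** (E x ?\<mu> ** transpose (E x ?\<mu>)) ** ?D = ?D ** ?D"
      by simp
    then have "cmat (block (P x) (Q x) (R x) (S x) ** block (mat 1) 0 0 (- mat 1)
       ** transpose (block (P x) (Q x) (R x) (S x))) = cmat (block (mat 1) 0 0 (- mat 1))"
      by (simp add: E P Q R S block_mult cscale_mult_left cscale_mult_right cscale_cscale cscale_one
        map_matrix_block block_transpose cmat_simps matrix_ring_simps cscale_minus cscale_add transpose_cscale
        transpose_minus block_inject)
    then show ?thesis
      by (simp only: cmat_eq_iff)
  qed
  show ?thesis
    using P Q R S pseudo frame_real_form(2)[OF frame D QE D\<theta>] by (rule that)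
qed

subsection \<open>The dressing matrix\<close>

text \<open>Equal Gram matrices give the transposes of \<open>a\<close> and \<open>b\<close> the
  same norm on every vector, hence the same kernel. The transpose of \<open>one\<close> writes a
  vector of this common kernel as zero.\<close>

lemma invertible_if_gram_eq:
  fixes a b :: "real^'n^'n"
  assumes gram: "a ** transpose a = b ** transpose b" and one: "b ** p + a ** q = mat 1"
  shows "\<exists>b'. b' ** b = mat 1 \<and> b ** b' = mat 1"
proof -
  have "w = 0" if w: "transpose b *v w = 0" for w
  proof -
    have "(transpose a *v w) \<bullet> (transpose a *v w) = w \<bullet> ((a ** transpose a) *v w)"
      by (simp add: dot_lmul_matrix matrix_vector_mul_assoc[symmetric])
    also have "\<dots> = w \<bullet> (b *v (transpose b *v w))"
      by (simp only: gram matrix_vector_mul_assoc)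
    finally have "transpose a *v w = 0"
      by (simp only: w) simp
    moreover have "w = transpose (b ** p + a ** q) *v w"
      by (simp add: one)
    then have "w = transpose p *v (transpose b *v w) + transpose q *v (transpose a *v w)"
      by (simp only: transpose_simps matrix_vector_mult_add_rdistrib matrix_vector_mul_assoc)
    ultimately show "w = 0"
      using w by (simp del: transpose_matrix_vector)
  qed
  then obtain c where "c ** transpose b = mat 1"
    using matrix_left_invertible_ker[of "transpose b"] by blast
  then have "b ** transpose c = mat 1"
    by (metis matrix_transpose_mul transpose_mat transpose_transpose)
  then show ?thesis
    using matrix_left_right_inverse by blast
qed

lemma smooth_on_gauge_form:
  assumes "smooth_on UNIV F"
  shows "smooth_on UNIV (\<lambda>x. gauge_form (F x) u)"
proof -
  have "linear (\<lambda>X. gauge_form X u)"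
    by (rule linearI) (simp_all add: gauge_form_def transpose_simps matrix_ring_simps algebra_simps)
  from smooth_on_linear[OF this assms] show ?thesis .
qed

text \<open>The Riccati equation expresses the derivative of \<open>T\<close> by \<open>T\<close> itself, so the class of \<open>T\<close>
  bootstraps from continuity.\<close>

lemma smooth_on_riccati:
  fixes T :: "real^'n \<Rightarrow> real^'n^'n"
  assumes F: "smooth_on UNIV F"
    and T: "\<And>x. (T has_derivative (\<lambda>u. T x ** gauge_form (F x) u - gauge_form (transpose (F x)) u ** T x
      + s *\<^sub>R (T x ** delta u ** T x - delta u))) (at x)"
  shows "smooth_on UNIV T"
  unfolding smooth_on_def
proof
  fix k
  have neg: "C_k_on k UNIV f \<Longrightarrow> C_k_on k UNIV (\<lambda>x. - f x)" for k and f :: "real^'n \<Rightarrow> real^'n^'n"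
    by (rule C_k_on_bounded_linear[OF bounded_linear_minus[OF bounded_linear_ident]])
  have scale: "C_k_on k UNIV f \<Longrightarrow> C_k_on k UNIV (\<lambda>x. s *\<^sub>R f x)" for k and f :: "real^'n \<Rightarrow> real^'n^'n"
    by (rule C_k_on_bounded_linear[OF bounded_linear_scaleR_right])
  have diff: "C_k_on k UNIV f \<Longrightarrow> C_k_on k UNIV g \<Longrightarrow> C_k_on k UNIV (\<lambda>x. f x - g x)"
    for k and f g :: "real^'n \<Rightarrow> real^'n^'n"
    using C_k_on_add[OF _ neg, of k f g] by simp
  show "C_k_on k UNIV T"
  proof (induction k)
    case 0
    show ?case
      using T by (auto intro!: continuous_at_imp_continuous_on has_derivative_continuous)
  next
    case (Suc k)
    have "C_k_on k UNIV (\<lambda>x. gauge_form (F x) u)" "C_k_on k UNIV (\<lambda>x. gauge_form (transpose (F x)) u)" for u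
      using smooth_on_gauge_form[OF F] smooth_on_gauge_form[OF smooth_on_linear[OF linear_transpose F]]
      by (auto simp: smooth_on_def)
    then show ?case
      by (intro C_k_on_SucI[OF T] C_k_on_add diff scale C_k_on_matrix_mult Suc C_k_on_const)
  qed
qed

text \<open>The row \<open>(\<beta>, -1)\<close> times the block matrix is \<open>(a, -b)\<close>.
  The row is null for \<open>diag(1, -1)\<close> as \<beta> is orthogonal, and the block matrix
  preserves the form, so \<open>a a^t = b b^t\<close>. This yields invertibility of \<open>b\<close>
  and orthogonality of \<open>T = b^{-1} a\<close>. The pair obeys a linear equation, which becomes
  a Riccati equation for the quotient.\<close>

lemma dressing_matrix:
  fixes P Q R S :: "real^'n \<Rightarrow> real^'n^'n"
  assumes \<beta>: "orthogonal_matrix \<beta>"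
    and pseudo: "\<And>x. block (P x) (Q x) (R x) (S x) ** block (mat 1) 0 0 (- mat 1)
       ** transpose (block (P x) (Q x) (R x) (S x)) = block (mat 1) 0 0 (- mat 1)"
    and deriv: "\<And>x. ((\<lambda>x. block (P x) (Q x) (R x) (S x)) has_derivative
       (\<lambda>u. block (P x) (Q x) (R x) (S x) ** block (gauge_form (F x) u) (s *\<^sub>R delta u)
         (s *\<^sub>R delta u) (gauge_form (transpose (F x)) u))) (at x)"
  obtains T b' where "\<And>x. (S x - \<beta> ** Q x) ** b' x = mat 1"
    "\<And>x. T x = b' x ** (\<beta> ** P x - R x)"
    "\<And>x. orthogonal_matrix (T x)"
    "\<And>x. (T has_derivative (\<lambda>u. T x ** gauge_form (F x) u - gauge_form (transpose (F x)) u ** T x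
      + s *\<^sub>R (T x ** delta u ** T x - delta u))) (at x)"
proof -
  define a where "a x = \<beta> ** P x - R x" for x
  define b where "b x = S x - \<beta> ** Q x" for x
  have PQ: "P x ** transpose (P x) - Q x ** transpose (Q x) = mat 1"
    and PR: "P x ** transpose (R x) - Q x ** transpose (S x) = 0"
    and RP: "R x ** transpose (P x) - S x ** transpose (Q x) = 0"
    and RS: "R x ** transpose (R x) - S x ** transpose (S x) = - mat 1" for x
    using pseudo[of x]
    by (simp_all add: block_mult block_transpose matrix_ring_simps block_inject)
  have \<beta>\<beta>: "\<beta> ** transpose \<beta> = mat 1"
    using \<beta> by (simp add: orthogonal_matrix_def)
  have "a x ** transpose (a x) - b x ** transpose (b x) =
     \<beta> ** (P x ** transpose (P x) - Q x ** transpose (Q x)) ** transpose \<beta>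
     - \<beta> ** (P x ** transpose (R x) - Q x ** transpose (S x))
     - (R x ** transpose (P x) - S x ** transpose (Q x)) ** transpose \<beta>
     + (R x ** transpose (R x) - S x ** transpose (S x))" for x
    by (simp add: a_def b_def matrix_ring_simps transpose_simps algebra_simps)
  then have gram: "a x ** transpose (a x) = b x ** transpose (b x)" for x
    by (simp add: PQ PR RP RS \<beta>\<beta>)
  \<comment> \<open>This identity excludes a common kernel of the transposes of \<open>a x\<close>
    and \<open>b x\<close>, as invertibility of \<open>b x\<close> requires.\<close>
  have one: "b x ** transpose (S x) + a x ** transpose (R x) = mat 1" for x
  proof -
    have "b x ** transpose (S x) + a x ** transpose (R x) =
       \<beta> ** (P x ** transpose (R x) - Q x ** transpose (S x)) 
       - (R x ** transpose (R x) - S x ** transpose (S x))"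
      by (simp add: a_def b_def matrix_ring_simps algebra_simps)
    then show ?thesis
      by (simp add: PR RS)
  qed
  obtain b' where b': "b' x ** b x = mat 1" "b x ** b' x = mat 1" for x
    using invertible_if_gram_eq[OF gram one] by metis
  define T where "T x = b' x ** a x" for x
  have bT: "b x ** T x = a x" for x
    by (simp add: T_def matrix_mul_assoc b')
  have "T x ** transpose (T x) = b' x ** (b x ** transpose (b x)) ** transpose (b' x)" for x
    by (simp add: T_def transpose_simps matrix_mul_assoc gram[symmetric])
  also have "\<dots> x = (b' x ** b x) ** transpose (b' x ** b x)" for x
    by (simp add: transpose_simps matrix_mul_assoc)
  finally have orth: "orthogonal_matrix (T x)" for x
    by (simp add: b' orthogonal_matrix matrix_left_right_inverse)

  let ?a0 = "\<lambda>x u. gauge_form (F x) u" and ?b0 = "\<lambda>x u. gauge_form (transpose (F x)) u"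
  note blocks = block_has_derivative_blocks[OF deriv[unfolded block_mult]]
  note lin = bounded_linear.has_derivative[OF bounded_bilinear.bounded_linear_right[OF bounded_bilinear_matrix_mult]]
  have a': "(a has_derivative (\<lambda>u. a x ** ?a0 x u - s *\<^sub>R (b x ** delta u))) (at x)" for x
  proof -
    have "(a has_derivative (\<lambda>u. \<beta> ** (P x ** ?a0 x u + Q x ** (s *\<^sub>R delta u))
        - (R x ** ?a0 x u + S x ** (s *\<^sub>R delta u)))) (at x)"
      unfolding a_def[abs_def] by (rule has_derivative_diff[OF lin[OF blocks(1)] blocks(3)])
    then show ?thesis
      by (simp add: a_def b_def matrix_ring_simps algebra_simps)
  qed
  have b'': "(b has_derivative (\<lambda>u. b x ** ?b0 x u - s *\<^sub>R (a x ** delta u))) (at x)" for x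
  proof -
    have "(b has_derivative (\<lambda>u. (R x ** (s *\<^sub>R delta u) + S x ** ?b0 x u)
        - \<beta> ** (P x ** (s *\<^sub>R delta u) + Q x ** ?b0 x u))) (at x)"
      unfolding b_def[abs_def] by (rule has_derivative_diff[OF blocks(4) lin[OF blocks(2)]])
    then show ?thesis
      by (simp add: a_def b_def matrix_ring_simps algebra_simps)
  qed
  have T': "(T has_derivative (\<lambda>u. T x ** ?a0 x u - ?b0 x u ** T x
      + s *\<^sub>R (T x ** delta u ** T x - delta u))) (at x)" (is "(T has_derivative ?T) _") for x
  proof -
    have "det (b y) \<noteq> 0" for y
      unfolding invertible_det_nz[symmetric] invertible_def using b'[of y] by blast
    then have "T differentiable at x"
      by (rule differentiable_matrix_solve[OF differentiableI[OF b''] differentiableI[OF a'] _ bT])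
    then obtain D where D: "(T has_derivative D) (at x)"
      by (auto simp: differentiable_def)
    \<comment> \<open>With differentiability of \<open>T\<close> secured, \<open>b T = a\<close> may
      be differentiated; uniqueness of derivatives gives a linear equation for
      \<open>D\<close>.\<close>
    from matrix_mult_has_derivative[OF b'' D]
    have *: "(\<lambda>u. b x ** D u + (b x ** ?b0 x u - s *\<^sub>R (a x ** delta u)) ** T x) =
        (\<lambda>u. a x ** ?a0 x u - s *\<^sub>R (b x ** delta u))"
      unfolding bT by (rule has_derivative_unique[OF _ a'])
    have "b x ** D u = a x ** ?a0 x u - s *\<^sub>R (b x ** delta u)
        - (b x ** ?b0 x u - s *\<^sub>R (a x ** delta u)) ** T x" for u
      using fun_cong[OF *, of u] by (simp only: eq_diff_eq)
    also have "\<dots> u = b x ** ?T u" for u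
      unfolding bT[of x, symmetric] by (simp add: matrix_ring_simps algebra_simps)
    finally have "b' x ** (b x ** D u) = b' x ** (b x ** ?T u)" for u
      by simp
    then have "D u = ?T u" for u
      by (simp add: matrix_mul_assoc b')
    then have "D = ?T"
      by (rule ext)
    with D show ?thesis
      by simp
  qed
  show ?thesis
    using b'(2) T_def orth T' unfolding a_def b_def by (rule that)
qed

subsection \<open>The Baecklund transformation\<close>

text \<open>In other words \<open>s\<close> is the cotangent of the angle; this is the only link
  between the angle and the spectral parameter.\<close>

lemma cos_arctan_inverse: "s \<noteq> 0 \<Longrightarrow> cos (arctan (1 / s)) = s * sin (arctan (1 / s))"
  by (simp add: sin_arctan cos_arctan)

text \<open>Both frames are defined globally over the same parameters, so the identity is the
  diffeomorphism and \<open>U\<close> itself serves as the neighbourhood of each of its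
  points.\<close>

lemma baecklund_of_riccati:
  fixes R :: "real^'n \<Rightarrow> real^('n + 'n)^('n::finite + 'n)"
  assumes R: "smooth_on UNIV R" "\<And>x. orthogonal_matrix (R x)"
      "\<And>x. (R has_derivative (\<lambda>u. R x ** block (gauge_form (F x) u) (- delta u) (delta u)
       (gauge_form (transpose (F x)) u))) (at x)"
    and A: "smooth_on UNIV A" "\<And>x. orthogonal_matrix (A x)"
      "\<And>x. (A has_derivative (\<lambda>u. A x ** gauge_form (F x) u)) (at x)"
    and T: "smooth_on UNIV T" "\<And>x. orthogonal_matrix (T x)"
      "\<And>x. (T has_derivative (\<lambda>u. T x ** gauge_form (F x) u - gauge_form (transpose (F x)) u ** T x
      + s *\<^sub>R (T x ** delta u ** T x - delta u))) (at x)"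
    and s: "s \<noteq> 0" and \<rho>: "\<rho> = arctan (1 / s)"
    and g_def: "\<And>x. g x = R x ** block (transpose (A x)) 0 0 (T x ** transpose (A x))"
    and h_def: "\<And>x. h x = g x ** block (cos \<rho> *\<^sub>R mat 1) (- sin \<rho> *\<^sub>R mat 1)
       (sin \<rho> *\<^sub>R mat 1) (cos \<rho> *\<^sub>R mat 1)"
    and v_def: "v = (\<lambda>x. column (Inl k) (g x))" and vt_def: "vt = (\<lambda>x. column (Inl k) (h x))"
    and U: "open U" "\<And>x. x \<in> U \<Longrightarrow> inj (frechet_derivative v (at x))"
      "\<And>x. x \<in> U \<Longrightarrow> inj (frechet_derivative vt (at x))"
  shows "baecklund_transformation k \<rho> U v U vt (\<lambda>x. x)"
proof -
  let ?Rot = "block (cos \<rho> *\<^sub>R mat 1) (- sin \<rho> *\<^sub>R mat 1)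
       (sin \<rho> *\<^sub>R mat 1) (cos \<rho> *\<^sub>R mat 1) :: real^('n + 'n)^('n::finite + 'n)"
  have Tt: "T x ** transpose (T x) = mat 1" "T x ** (transpose (T x) ** M) = M"
    "transpose (T x) ** (T x ** M) = M" for x and M :: "real^'n^'n"
    using T(2)[of x] by (simp_all add: orthogonal_matrix_def matrix_mul_assoc)
  have At: "A x ** transpose (A x) = mat 1" "transpose (A x) ** (A x ** M) = M"
    for x and M :: "real^'n^'n"
    using A(2)[of x] by (simp_all add: orthogonal_matrix_def matrix_mul_assoc)
  have smooth_g: "smooth_on UNIV g"
    unfolding g_def[abs_def]
    by (intro smooth_on_matrix_mult smooth_on_block_diag R T smooth_on_linear[OF linear_transpose A(1)])
  then have smooth_h: "smooth_on UNIV h"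
    unfolding h_def[abs_def] by (intro smooth_on_matrix_mult smooth_on_const)
  have "orthogonal_matrix (block (transpose (A x)) 0 0 (T x ** transpose (A x)))" for x
    using A(2)[of x] T(2)[of x]
    by (simp add: orthogonal_matrix matrix_left_right_inverse block_transpose block_mult
        transpose_simps matrix_mul_assoc[symmetric] At Tt flip: block_one)
  then have orth_g: "orthogonal_matrix (g x)" for x
    unfolding g_def by (intro orthogonal_matrix_mul R)
  have orth_Rot: "orthogonal_matrix ?Rot"
    by (simp add: orthogonal_matrix block_transpose block_mult transpose_simps matrix_ring_simps
        block_inject mult.commute scaleR_add_left[symmetric] power2_eq_square[symmetric]
        flip: block_one)
  then have orth_h: "orthogonal_matrix (h x)" for x
    unfolding h_def by (intro orthogonal_matrix_mul orth_g)
  \<comment> \<open>This is \<open>g^{-1} dg\<close>. The factor \<open>A^t\<close> gauges away the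
    upper left block, and the Riccati equation reduces the lower right block to its terms with
    \<open>s\<close>.\<close>
  define \<Omega> where "\<Omega> x u = block 0 (- (A x ** delta u ** T x ** transpose (A x)))
      (A x ** transpose (T x) ** delta u ** transpose (A x))
      (s *\<^sub>R (A x ** delta u ** T x ** transpose (A x) - A x ** transpose (T x) ** delta u ** transpose (A x)))" for x u
  have g': "(g has_derivative (\<lambda>u. g x ** \<Omega> x u)) (at x)" for x
  proof -
    let ?a0 = "\<lambda>u. gauge_form (F x) u" and ?b0 = "\<lambda>u. gauge_form (transpose (F x)) u"
    let ?dT = "\<lambda>u. T x ** ?a0 u - ?b0 u ** T x + s *\<^sub>R (T x ** delta u ** T x - delta u)"
    have dA: "((\<lambda>x. transpose (A x)) has_derivative (\<lambda>u. transpose (A x ** ?a0 u))) (at x)"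
      by (rule bounded_linear.has_derivative[OF linear_transpose[unfolded linear_conv_bounded_linear] A(3)])
    have "(g has_derivative (\<lambda>u. R x ** block (transpose (A x ** ?a0 u)) 0 0
          (T x ** transpose (A x ** ?a0 u) + ?dT u ** transpose (A x))
        + (R x ** block (?a0 u) (- delta u) (delta u) (?b0 u)) **
          block (transpose (A x)) 0 0 (T x ** transpose (A x)))) (at x)"
      unfolding g_def[abs_def]
      by (rule matrix_mult_has_derivative[OF R(3)
            block_diag_has_derivative[OF dA matrix_mult_has_derivative[OF T(3) dA]]])
    moreover have "R x ** block (transpose (A x ** ?a0 u)) 0 0
          (T x ** transpose (A x ** ?a0 u) + ?dT u ** transpose (A x))
        + (R x ** block (?a0 u) (- delta u) (delta u) (?b0 u)) **
          block (transpose (A x)) 0 0 (T x ** transpose (A x)) = g x ** \<Omega> x u" for u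
      unfolding g_def \<Omega>_def matrix_mul_assoc[symmetric] matrix_add_ldistrib[symmetric]
      by (simp add: block_mult block_add transpose_gauge_form transpose_simps matrix_ring_simps At Tt
          algebra_simps)
    ultimately show ?thesis
      by simp
  qed
  \<comment> \<open>The rotation is constant, so the connection form is merely conjugated by
    it.\<close>
  have h': "(h has_derivative (\<lambda>u. h x ** (transpose ?Rot ** \<Omega> x u ** ?Rot))) (at x)" for x
  proof -
    have "(h has_derivative (\<lambda>u. g x ** \<Omega> x u ** ?Rot)) (at x)"
      unfolding h_def[abs_def] by (rule bounded_linear.has_derivative[OF
            bounded_bilinear.bounded_linear_left[OF bounded_bilinear_matrix_mult] g'])
    moreover have "h x ** (transpose ?Rot ** M) = g x ** M" for M :: "real^('n + 'n)^('n + 'n)"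
      using orth_Rot unfolding h_def orthogonal_matrix_def
      by (metis matrix_mul_assoc matrix_mul_lid)
    ultimately show ?thesis
      by (simp add: matrix_mul_assoc[symmetric])
  qed
  have upper: "\<Omega> x u $ Inl a $ Inl b = 0" for x u a b
    by (simp add: \<Omega>_def)
  txt \<open>With \<open>Y\<close>, \<open>Z\<close> the off-diagonal blocks of \<open>\<Omega>\<close> this block is
    \<open>sin \<rho> (cos \<rho> (Y + Z) - s sin \<rho> (Y + Z))\<close>.\<close>
  have "(transpose ?Rot ** \<Omega> x u ** ?Rot) $ Inl a $ Inl b = 0" for x u a b
  proof -
    have "cos \<rho> = s * sin \<rho>"
      using cos_arctan_inverse[OF s] \<rho> by simp
    then show ?thesis
      by (simp add: \<Omega>_def block_mult block_transpose matrix_ring_simps transpose_simps algebra_simps)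
  qed
  then have "adapted_frame k U vt h"
    unfolding vt_def using U(3)[unfolded vt_def]
    by (intro adapted_frameI[OF smooth_on_subset[OF smooth_h subset_UNIV] orth_h h'])
  moreover have "adapted_frame k U v g"
    unfolding v_def using upper U(2)[unfolded v_def]
    by (intro adapted_frameI[OF smooth_on_subset[OF smooth_g subset_UNIV] orth_g g'])
  moreover have "immersed_submanifold U v" "immersed_submanifold U vt"
    unfolding v_def vt_def using U[unfolded v_def vt_def] smooth_g smooth_h orth_g orth_h
    by (auto intro!: immersed_submanifold_columnI)
  ultimately show ?thesis
    unfolding baecklund_transformation_def
  proof (intro conjI ballI)
    fix p assume "p \<in> U"
    with \<open>adapted_frame k U v g\<close> \<open>adapted_frame k U vt h\<close> U(1)
    show "\<exists>W g h. open W \<and> p \<in> W \<and> W \<subseteq> U \<and> adapted_frame k W v g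
        \<and> adapted_frame k ((\<lambda>x. x) ` W) vt h \<and> (\<forall>x\<in>W. h x = g x ** ?Rot)"
      by (intro exI[of _ U]) (rule exI[of _ g], rule exI[of _ h], simp add: h_def)
  qed (simp_all add: diffeomorphism_on_ident)
qed

text \<open>The first \<open>n\<close> columns of a product see only the left half of the right
  factor. Hence \<open>N\<close> and \<open>g\<close>, and likewise \<open>Nt\<close> and
  \<open>h\<close>, can share column \<open>Inl k\<close> although their last \<open>n\<close>
  columns differ.\<close>

lemma column_Inl_block: "column (Inl k) (M ** block P Q R S) = column (Inl k) (M ** block P Q' R S')"
  by (simp add: vec_eq_iff column_def matrix_matrix_mult_def sum_UNIV_Plus)

lemma column_cmat: "column k (cmat M) = cvec (column k M)"
  by (simp add: vec_eq_iff column_def cvec_def)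

theorem theorem14p5:
  fixes F :: "real^'n \<Rightarrow> real^'n^'n::finite"
    and E :: "real^'n \<Rightarrow> complex \<Rightarrow> complex^('n + 'n)^('n + 'n)"
    and \<eta>\<^sub>1 \<eta>\<^sub>2 \<eta>\<^sub>3 \<eta>\<^sub>4 \<beta>t At :: "real^'n \<Rightarrow> complex^'n^'n"
    and A B :: "real^'n \<Rightarrow> real^'n^'n"
    and N Nt :: "real^'n \<Rightarrow> complex^('n + 'n)^('n + 'n)"
    and \<beta> :: "real^'n^'n"
    and s \<rho> :: real
    and k :: 'n
  assumes "Gnn_solution F"
    and "is_frame F E"
    and "s \<noteq> 0"
    and "orthogonal_matrix \<beta>"
    and "\<And>x. E x (- (\<i> * complex_of_real s)) = block (\<eta>\<^sub>1 x) (\<eta>\<^sub>2 x) (\<eta>\<^sub>3 x) (\<eta>\<^sub>4 x)"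
    and "\<And>x. \<beta>t x = matrix_inv (cscale \<i> (\<eta>\<^sub>4 x) - cmat \<beta> ** \<eta>\<^sub>2 x)
                      ** (cscale \<i> (cmat \<beta> ** \<eta>\<^sub>1 x) + \<eta>\<^sub>3 x)"
    and "\<And>x. E x 0 = cmat (block (A x) 0 0 (B x))"
    and "\<rho> = arctan (1 / s)"
    and "\<And>x. At x = cmat (A x) ** transpose (\<beta>t x)"
    and "\<And>x. N x = E x 1 ** block (cmat (transpose (A x))) 0 0 (mat 1)"
    and "\<And>x. Nt x = N x ** block (cmat (A x)) 0 0 (mat 1)
                      ** block (cos \<rho> *\<^sub>R transpose (\<beta>t x)) (- sin \<rho> *\<^sub>R mat 1)
                               (sin \<rho> *\<^sub>R mat 1) (cos \<rho> *\<^sub>R \<beta>t x)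
                      ** block (transpose (At x)) 0 0 (mat 1)"
  shows "\<exists>v vt :: real^'n \<Rightarrow> real^('n + 'n).
           (\<forall>x. column (Inl k) (N x) = cvec (v x)) \<and>
           (\<forall>x. column (Inl k) (Nt x) = cvec (vt x)) \<and>
           (\<forall>U. open U \<and> (\<forall>x\<in>U. inj (frechet_derivative v (at x)) \<and> inj (frechet_derivative vt (at x)))
              \<longrightarrow> baecklund_transformation k \<rho> U v U vt (\<lambda>x. x))"
proof -
  obtain R where R: "\<And>x. E x 1 = cmat (R x)" "\<And>x. orthogonal_matrix (R x)" "smooth_on UNIV R"
    "\<And>x. (R has_derivative (\<lambda>u. R x ** block (gauge_form (F x) u) (- delta u) (delta u)
       (gauge_form (transpose (F x)) u))) (at x)"
    by (rule frame_at_one[OF assms(2)]) (rule that)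
  note A = frame_at_zero[OF assms(2,7)]
  obtain p q r t where p: "\<And>x. \<eta>\<^sub>1 x = cmat (p x)" and q: "\<And>x. \<eta>\<^sub>2 x = cscale \<i> (cmat (q x))"
    and r: "\<And>x. \<eta>\<^sub>3 x = cscale (- \<i>) (cmat (r x))" and t: "\<And>x. \<eta>\<^sub>4 x = cmat (t x)"
    and pseudo: "\<And>x. block (p x) (q x) (r x) (t x) ** block (mat 1) 0 0 (- mat 1)
       ** transpose (block (p x) (q x) (r x) (t x)) = block (mat 1) 0 0 (- mat 1)"
    and deriv: "\<And>x. ((\<lambda>x. block (p x) (q x) (r x) (t x)) has_derivative
       (\<lambda>u. block (p x) (q x) (r x) (t x) ** block (gauge_form (F x) u) (s *\<^sub>R delta u)
         (s *\<^sub>R delta u) (gauge_form (transpose (F x)) u))) (at x)"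
    by (rule frame_at_imaginary[OF assms(2,5)]) (rule that)
  obtain T b' where b': "\<And>x. (t x - \<beta> ** q x) ** b' x = mat 1"
    and T_eq: "\<And>x. T x = b' x ** (\<beta> ** p x - r x)"
    and T: "\<And>x. orthogonal_matrix (T x)"
    "\<And>x. (T has_derivative (\<lambda>u. T x ** gauge_form (F x) u - gauge_form (transpose (F x)) u ** T x
      + s *\<^sub>R (T x ** delta u ** T x - delta u))) (at x)"
    by (rule dressing_matrix[OF assms(4) pseudo deriv]) (rule that)
  have "smooth_on UNIV F"
    using assms(1) by (simp add: Gnn_solution_def)
  then have smooth_T: "smooth_on UNIV T"
    using T(2) by (rule smooth_on_riccati)
  have \<beta>t: "\<beta>t x = cmat (T x)" for x
  proof -
    \<comment> \<open>Denominator and numerator each carry a factor \<open>i\<close>; the two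
      cancel, which leaves the real matrix \<open>T x\<close>.\<close>
    have den: "cscale \<i> (\<eta>\<^sub>4 x) - cmat \<beta> ** \<eta>\<^sub>2 x = cscale \<i> (cmat (t x - \<beta> ** q x))"
      by (simp add: q t cmat_simps cscale_add cscale_mult_right)
    have num: "cscale \<i> (cmat \<beta> ** \<eta>\<^sub>1 x) + \<eta>\<^sub>3 x = cscale \<i> (cmat (\<beta> ** p x - r x))"
      by (simp add: p r cmat_simps cscale_add cscale_minus)
    have "cscale \<i> (cmat (t x - \<beta> ** q x)) ** cscale (- \<i>) (cmat (b' x)) = mat 1"
      using b'[of x] by (simp add: cscale_mult_left cscale_mult_right cscale_cscale cscale_one
          cmat_one flip: cmat_mult)
    note inv = matrix_inv_eqI[OF this]
    show ?thesis
      unfolding assms(6) den num inv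
      by (simp add: cscale_mult_left cscale_mult_right cscale_cscale cscale_one T_eq cmat_mult)
  qed
  \<comment> \<open>The lower factor \<open>T A^t\<close>, in place of the identity in
    \<open>N\<close>, is chosen so that the left half of \<open>Nt\<close> becomes \<open>g\<close>
    times the left half of a constant rotation.\<close>
  define g where "g x = R x ** block (transpose (A x)) 0 0 (T x ** transpose (A x))" for x
  define h where "h x = g x ** block (cos \<rho> *\<^sub>R mat 1) (- sin \<rho> *\<^sub>R mat 1)
       (sin \<rho> *\<^sub>R mat 1) (cos \<rho> *\<^sub>R mat 1)" for x
  have N: "column (Inl k) (N x) = cvec (column (Inl k) (g x))" for x
  proof -
    have "N x = cmat (R x ** block (transpose (A x)) 0 0 (mat 1))"
      by (simp add: assms(10) R(1) cmat_simps map_matrix_block)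
    moreover have "column (Inl k) (g x) = column (Inl k) (R x ** block (transpose (A x)) 0 0 (mat 1))"
      unfolding g_def by (rule column_Inl_block)
    ultimately show ?thesis
      by (simp add: column_cmat)
  qed
  have Nt: "column (Inl k) (Nt x) = cvec (column (Inl k) (h x))" for x
  proof -
    have T1: "transpose (T x) ** (T x ** M) = M" and A1: "transpose (A x) ** A x = mat 1" for M
      using T(1)[of x] A(1)[of x] by (simp_all add: orthogonal_matrix_def matrix_mul_assoc)
    have "Nt x = cmat (R x ** block (transpose (A x)) 0 0 (mat 1) ** block (A x) 0 0 (mat 1)
       ** block (cos \<rho> *\<^sub>R transpose (T x)) (- sin \<rho> *\<^sub>R mat 1) (sin \<rho> *\<^sub>R mat 1) (cos \<rho> *\<^sub>R T x)
       ** block (T x ** transpose (A x)) 0 0 (mat 1))"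
      by (simp add: assms(9-11) \<beta>t R(1) cmat_simps map_matrix_block transpose_simps)
    also have "\<dots> = cmat (R x ** block (cos \<rho> *\<^sub>R transpose (A x)) (- sin \<rho> *\<^sub>R mat 1)
       (sin \<rho> *\<^sub>R T x ** transpose (A x)) (cos \<rho> *\<^sub>R T x))"
      by (simp add: matrix_mul_assoc[symmetric] block_mult A1 T1 matrix_ring_simps)
    finally have Nt_col: "column (Inl k) (Nt x) = cvec (column (Inl k) (R x ** block (cos \<rho> *\<^sub>R transpose (A x))
        (- sin \<rho> *\<^sub>R mat 1) (sin \<rho> *\<^sub>R T x ** transpose (A x)) (cos \<rho> *\<^sub>R T x)))"
      by (simp add: column_cmat)
    have hx: "h x = R x ** block (cos \<rho> *\<^sub>R transpose (A x)) (- sin \<rho> *\<^sub>R transpose (A x))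
       (sin \<rho> *\<^sub>R T x ** transpose (A x)) (cos \<rho> *\<^sub>R T x ** transpose (A x))"
      by (simp add: h_def g_def matrix_mul_assoc[symmetric] block_mult matrix_ring_simps)
    have "column (Inl k) (h x) = column (Inl k) (R x ** block (cos \<rho> *\<^sub>R transpose (A x))
        (- sin \<rho> *\<^sub>R mat 1) (sin \<rho> *\<^sub>R T x ** transpose (A x)) (cos \<rho> *\<^sub>R T x))"
      unfolding hx by (rule column_Inl_block)
    with Nt_col show ?thesis
      by simp
  qed
  show ?thesis
    using N Nt baecklund_of_riccati[OF R(3,2,4) A(2,1,3) smooth_T T assms(3,8) g_def h_def refl refl]
    by (intro exI[of _ "\<lambda>x. column (Inl k) (g x)"] exI[of _ "\<lambda>x. column (Inl k) (h x)"]) (intro conjI allI impI, simp_all)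
qed

end
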